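(* Let $G$ be a connected non-bipartite graph and let $\Gamma=(G,\sigma)\in\mathbb{FS}_1(G)$ with principal weak automorphism $\varphi$ of order $2$ whose set of fixed vertices $F$ is nonempty. Suppose $\Gamma$ has only one $\varphi$-factor, so that $V(G)=F\cup U_1\cup U_2$ with $\varphi(U_1)=U_2$ and $G[U_1\cup U_2]$ the unique $\varphi$-factor. Then, for some bipartition $(\Omega_1,\Omega_2)$ of the bipartite graph $G[F]$, $\Gamma$ is switching isomorphic to a signed graph $\hat\Gamma^a$ or $\hat\Gamma^b$ whose adjacency matrix, with rows and columns in the block order $\Omega_1,\Omega_2,U_1,U_2$, has respectively the form $$A(\hat\Gamma^a)=\begin{pmatrix} 0 & A & D_1 & D_1 \\ A^\top & 0 & D_2 & -D_2 \\ D_1^\top & D_2^\top & B & Y \\ D_1^\top & -D_2^\top & -Y & -B \end{pmatrix},\qquad A(\hat\Gamma^b)=\begin{pmatrix} 0 & A & D_1 & -D_1 \\ A^\top & 0 & D_2 & D_2 \\ D_1^\top & D_2^\top & B & Y \\ -D_1^\top & D_2^\top & -Y & -B \end{pmatrix},$$ where $A,B,Y,D_1,D_2$ are matrices with entries in $\{0,1,-1\}$, $B^\top=B$ has zero diagonal, and $Y^\top=-Y$.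
   Context: Graphs are finite and simple. A signed graph $\Gamma=(G,\sigma)$ on $G$ is $G$ with a function $\sigma:E(G)\to\{+1,-1\}$; its adjacency matrix has $(u,v)$-entry $\sigma(uv)$ if $uv\in E(G)$ and $0$ otherwise. Switching $\Gamma$ with respect to $U\subseteq V(G)$ reverses the signs of all edges between $U$ and $V(G)\setminus U$. $\Gamma\simeq\Gamma'$ (switching isomorphic) means $\Gamma$ is isomorphic, by a sign-preserving graph isomorphism, to a switching of $\Gamma'$. $\Gamma$ is sign-symmetric if $\Gamma\simeq-\Gamma=(G,-\sigma)$. The sign of a cycle is the product of the signs of its edges. A weak automorphism of $\Gamma$ is a $\varphi\in Aut(G)$ with $\sigma(\varphi(C))=-\sigma(C)$ for every odd cycle $C$ of $G$ and $\sigma(\varphi(C))=\sigma(C)$ for every even cycle $C$. It is principal if it has the smallest order among all weak automorphisms of $\Gamma$. $\mathbb{S}_1(G)$ is the set of sign-symmetric signed graphs on $G$ having a principal weak automorphism of order $2$; for such $\varphi$, $F=\{v\in V(G)\mid\varphi(v)=v\}$, and $G[F]$ is a bipartite graph. $\mathbb{FS}_1(G)$ is the set of $\Gamma\in\mathbb{S}_1(G)$ with $F\neq\emptyset$ (for some such $\varphi$). $\varphi$-factors: $\varphi$ permutes the connected components of $G[V(G)\setminus F]$. A reflexive factor is a component mapped to itself by $\varphi$; a symmetric factor is the union of two distinct components interchanged by $\varphi$. These are the $\varphi$-factors. For each $\varphi$-factor the vertex set is written as a disjoint union of two sets interchanged by $\varphi$, each inducing a connected subgraph. "Bipartition $(\Omega_1,\Omega_2)$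 of $G[F]$" means $F=\Omega_1\sqcup\Omega_2$ with no edges inside $\Omega_1$ or inside $\Omega_2$ (one part may be empty). *)

theory Defs
  imports
    "Graph_Theory.Graph_Theory"
    "Jordan_Normal_Form.Matrix"
    "HOL-Combinatorics.Permutations"
begin

text \<open>
  A finite simple graph is a symmetric loop-free digraph without parallel arcs
  (\<^locale>\<open>pair_graph\<close>): the edge \<open>uv\<close> is the pair of arcs \<open>(u,v)\<close>, \<open>(v,u)\<close>.
  A signature is defined on the two-element sets \<open>{u,v}\<close>; its values on sets that are
  not edges are irrelevant to every notion below.
\<close>

type_synonym 'a signed_graph = "'a pair_pre_digraph \<times> ('a set \<Rightarrow> int)"

fun signed_graph :: "'a signed_graph \<Rightarrow> bool" where
  "signed_graph (G, \<sigma>) \<longleftrightarrow> pair_graph G \<and> (\<forall>(u, v) \<in> parcs G. \<sigma> {u, v} \<in> {1, -1})"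

fun neg :: "'a signed_graph \<Rightarrow> 'a signed_graph" where
  "neg (G, \<sigma>) = (G, \<lambda>e. - \<sigma> e)"

fun switching :: "'a set \<Rightarrow> 'a signed_graph \<Rightarrow> 'a signed_graph" where
  "switching U (G, \<sigma>) =
    (G, \<lambda>e. if e \<inter> U \<noteq> {} \<and> e \<inter> (pverts G - U) \<noteq> {} then - \<sigma> e else \<sigma> e)"

fun signed_iso :: "('a \<Rightarrow> 'b) \<Rightarrow> 'a signed_graph \<Rightarrow> 'b signed_graph \<Rightarrow> bool" where
  "signed_iso f (G, \<sigma>) (H, \<tau>) \<longleftrightarrow>
    bij_betw f (pverts G) (pverts H) \<and>
    (\<forall>u \<in> pverts G. \<forall>v \<in> pverts G. (f u, f v) \<in> parcs H \<longleftrightarrow> (u, v) \<in> parcs G) \<and>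
    (\<forall>(u, v) \<in> parcs G. \<tau> {f u, f v} = \<sigma> {u, v})"

definition switching_isomorphic :: "'a signed_graph \<Rightarrow> 'b signed_graph \<Rightarrow> bool" where
  "switching_isomorphic \<Gamma> \<Gamma>' \<longleftrightarrow>
    (\<exists>U \<subseteq> pverts (fst \<Gamma>'). \<exists>f. signed_iso f \<Gamma> (switching U \<Gamma>'))"

definition sign_symmetric :: "'a signed_graph \<Rightarrow> bool" where
  "sign_symmetric \<Gamma> \<longleftrightarrow> switching_isomorphic \<Gamma> (neg \<Gamma>)"

text \<open>
  Cycles are given by arc lists. In a symmetric digraph \<^const>\<open>pre_digraph.cycle\<close> also
  accepts the back-and-forth walk \<open>u v u\<close> along one edge, hence the bound on the length.
\<close>

definition graph_cycle :: "'a pair_pre_digraph \<Rightarrow> ('a \<times> 'a) list \<Rightarrow> bool" where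
  "graph_cycle G C \<longleftrightarrow> pre_digraph.cycle (with_proj G) C \<and> 3 \<le> length C"

definition cycle_sign :: "('a set \<Rightarrow> int) \<Rightarrow> ('a \<times> 'a) list \<Rightarrow> int" where
  "cycle_sign \<sigma> C = (\<Prod>(u, v) \<leftarrow> C. \<sigma> {u, v})"

definition graph_aut :: "'a pair_pre_digraph \<Rightarrow> ('a \<Rightarrow> 'a) set" where
  "graph_aut G = {\<phi>. \<phi> permutes pverts G \<and>
    (\<forall>u \<in> pverts G. \<forall>v \<in> pverts G. (\<phi> u, \<phi> v) \<in> parcs G \<longleftrightarrow> (u, v) \<in> parcs G)}"

fun weak_aut :: "'a signed_graph \<Rightarrow> ('a \<Rightarrow> 'a) \<Rightarrow> bool" where
  "weak_aut (G, \<sigma>) \<phi> \<longleftrightarrow> \<phi> \<in> graph_aut G \<and>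
    (\<forall>C. graph_cycle G C \<longrightarrow>
      cycle_sign \<sigma> (map (map_prod \<phi> \<phi>) C)
        = (if odd (length C) then - cycle_sign \<sigma> C else cycle_sign \<sigma> C))"

text \<open>
  Elements of \<^const>\<open>graph_aut\<close> are the identity outside the vertex set, so the order of
  an automorphism can be read off from equality of functions on the whole type.
\<close>

definition aut_order :: "('a \<Rightarrow> 'a) \<Rightarrow> nat" where
  "aut_order \<phi> = (LEAST n. 0 < n \<and> \<phi> ^^ n = id)"

definition principal_weak_aut :: "'a signed_graph \<Rightarrow> ('a \<Rightarrow> 'a) \<Rightarrow> bool" where
  "principal_weak_aut \<Gamma> \<phi> \<longleftrightarrow>
    weak_aut \<Gamma> \<phi> \<and> (\<forall>\<psi>. weak_aut \<Gamma> \<psi> \<longrightarrow> aut_order \<phi> \<le> aut_order \<psi>)"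

definition fixed_verts :: "'a pair_pre_digraph \<Rightarrow> ('a \<Rightarrow> 'a) \<Rightarrow> 'a set" where
  "fixed_verts G \<phi> = {v \<in> pverts G. \<phi> v = v}"

definition S1 :: "'a pair_pre_digraph \<Rightarrow> 'a signed_graph set" where
  "S1 G = {\<Gamma>. fst \<Gamma> = G \<and> signed_graph \<Gamma> \<and> sign_symmetric \<Gamma> \<and>
    (\<exists>\<phi>. principal_weak_aut \<Gamma> \<phi> \<and> aut_order \<phi> = 2)}"

definition FS1 :: "'a pair_pre_digraph \<Rightarrow> 'a signed_graph set" where
  "FS1 G = {\<Gamma> \<in> S1 G.
    \<exists>\<phi>. principal_weak_aut \<Gamma> \<phi> \<and> aut_order \<phi> = 2 \<and> fixed_verts G \<phi> \<noteq> {}}"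

definition bipartition :: "('a, 'b) pre_digraph \<Rightarrow> 'a set \<Rightarrow> 'a set \<Rightarrow> bool" where
  "bipartition H X Y \<longleftrightarrow> verts H = X \<union> Y \<and> X \<inter> Y = {} \<and>
    (\<forall>e \<in> arcs H. \<not> (tail H e \<in> X \<and> head H e \<in> X) \<and> \<not> (tail H e \<in> Y \<and> head H e \<in> Y))"

definition bipartite :: "('a, 'b) pre_digraph \<Rightarrow> bool" where
  "bipartite H \<longleftrightarrow> (\<exists>X Y. bipartition H X Y)"

text \<open>
  For a symmetric digraph the strongly connected components are the connected components.
  A \<open>\<phi>\<close>-factor is represented by its vertex set; the factor itself is the subgraph induced
  on that set.
\<close>

definition components_off_fixed :: "'a pair_pre_digraph \<Rightarrow> ('a \<Rightarrow> 'a) \<Rightarrow> 'a set set" where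
  "components_off_fixed G \<phi> =
    pre_digraph.sccs_verts (with_proj G \<restriction> (pverts G - fixed_verts G \<phi>))"

definition reflexive_factors :: "'a pair_pre_digraph \<Rightarrow> ('a \<Rightarrow> 'a) \<Rightarrow> 'a set set" where
  "reflexive_factors G \<phi> = {C \<in> components_off_fixed G \<phi>. \<phi> ` C = C}"

definition symmetric_factors :: "'a pair_pre_digraph \<Rightarrow> ('a \<Rightarrow> 'a) \<Rightarrow> 'a set set" where
  "symmetric_factors G \<phi> = {C \<union> D | C D. C \<in> components_off_fixed G \<phi> \<and>
    D \<in> components_off_fixed G \<phi> \<and> C \<noteq> D \<and> \<phi> ` C = D \<and> \<phi> ` D = C}"

definition phi_factors :: "'a pair_pre_digraph \<Rightarrow> ('a \<Rightarrow> 'a) \<Rightarrow> 'a set set" where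
  "phi_factors G \<phi> = reflexive_factors G \<phi> \<union> symmetric_factors G \<phi>"

text \<open>\<open>vs\<close> lists the vertices in the order in which they index rows and columns.\<close>

fun adj_mat :: "'a signed_graph \<Rightarrow> 'a list \<Rightarrow> int mat" where
  "adj_mat (G, \<sigma>) vs = mat (length vs) (length vs)
    (\<lambda>(i, j). if (vs ! i, vs ! j) \<in> parcs G then \<sigma> {vs ! i, vs ! j} else 0)"

definition block_mat_a :: "int mat \<Rightarrow> int mat \<Rightarrow> int mat \<Rightarrow> int mat \<Rightarrow> int mat \<Rightarrow> int mat" where
  "block_mat_a A B Y D1 D2 = four_block_mat
    (four_block_mat (0\<^sub>m (dim_row A) (dim_row A)) A
                    (transpose_mat A) (0\<^sub>m (dim_col A) (dim_col A)))
    (four_block_mat D1 D1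
                    D2 (- D2))
    (four_block_mat (transpose_mat D1) (transpose_mat D2)
                    (transpose_mat D1) (- transpose_mat D2))
    (four_block_mat B Y
                    (- Y) (- B))"

definition block_mat_b :: "int mat \<Rightarrow> int mat \<Rightarrow> int mat \<Rightarrow> int mat \<Rightarrow> int mat \<Rightarrow> int mat" where
  "block_mat_b A B Y D1 D2 = four_block_mat
    (four_block_mat (0\<^sub>m (dim_row A) (dim_row A)) A
                    (transpose_mat A) (0\<^sub>m (dim_col A) (dim_col A)))
    (four_block_mat D1 (- D1)
                    D2 D2)
    (four_block_mat (transpose_mat D1) (transpose_mat D2)
                    (- transpose_mat D1) (transpose_mat D2))
    (four_block_mat B Y
                    (- Y) (- B))"

definition admissible_blocks ::
  "nat \<Rightarrow> nat \<Rightarrow> nat \<Rightarrow> int mat \<Rightarrow> int mat \<Rightarrow> int mat \<Rightarrow> int mat \<Rightarrow> int mat \<Rightarrow> bool" where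
  "admissible_blocks p q n A B Y D1 D2 \<longleftrightarrow>
    A \<in> carrier_mat p q \<and> B \<in> carrier_mat n n \<and> Y \<in> carrier_mat n n \<and>
    D1 \<in> carrier_mat p n \<and> D2 \<in> carrier_mat q n \<and>
    (\<forall>M \<in> {A, B, Y, D1, D2}. elements_mat M \<subseteq> {0, 1, -1}) \<and>
    transpose_mat B = B \<and> (\<forall>i < n. B $$ (i, i) = 0) \<and> transpose_mat Y = - Y"

text \<open>
  The order of \<open>\<phi> ` U1\<close> is the one transported from \<open>U1\<close> by \<open>\<phi>\<close>. The orders of \<open>W1\<close>, \<open>W2\<close>
  and \<open>U1\<close> are immaterial (another choice permutes rows and columns of the five blocks),
  so all of them are required to give the stated form.
\<close>

definition has_block_form ::
  "(int mat \<Rightarrow> int mat \<Rightarrow> int mat \<Rightarrow> int mat \<Rightarrow> int mat \<Rightarrow> int mat) \<Rightarrow>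
    ('a \<Rightarrow> 'a) \<Rightarrow> 'a set \<Rightarrow> 'a set \<Rightarrow> 'a set \<Rightarrow> 'a signed_graph \<Rightarrow> bool" where
  "has_block_form form \<phi> W1 W2 U1 \<Gamma> \<longleftrightarrow>
    (\<forall>ws1 ws2 us. set ws1 = W1 \<and> distinct ws1 \<and> set ws2 = W2 \<and> distinct ws2 \<and>
        set us = U1 \<and> distinct us \<longrightarrow>
      (\<exists>A B Y D1 D2. admissible_blocks (length ws1) (length ws2) (length us) A B Y D1 D2 \<and>
        adj_mat \<Gamma> (ws1 @ ws2 @ us @ map \<phi> us) = form A B Y D1 D2))"

end

theory Submission
  imports
    Defs
    "HOL-Combinatorics.Cycles"
begin

text \<open>
  The condition on cycles says that the signature \<open>uv \<mapsto> - \<sigma>(uv) \<sigma>(\<phi>(u)\<phi>(v))\<close> is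
  balanced, so \<open>\<sigma>(\<phi>(u)\<phi>(v)) = - s(u) s(v) \<sigma>(uv)\<close> for some \<open>s : V \<rightarrow> {1, -1}\<close>. On an edge
  inside \<open>F\<close> this forces \<open>s(u) \<noteq> s(v)\<close>, so the values of \<open>s\<close> bipartition \<open>F\<close>. Applying
  \<open>\<phi>\<close> twice shows that \<open>s(u) s(\<phi>(u))\<close> is constant, hence \<open>1\<close> by its value on \<open>F\<close>.
  Switching at the vertices of \<open>U\<^sub>2\<close> with \<open>s = -1\<close> therefore makes \<open>s = 1\<close> off \<open>F\<close> without
  changing it on \<open>F\<close>, and the twist relation becomes form \<open>b\<close>.
\<close>

text \<open>Strong induction on the length: a repeated vertex splits off a shorter closed walk, and
  commutativity lets the two products be treated separately. Without a repetition the walk is empty,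
  a cycle, or runs back and forth along one edge.\<close>

lemma (in pair_graph) closed_walk_prod:
  fixes f :: "'a \<times> 'a \<Rightarrow> 'b::comm_monoid_mult"
  assumes cyc: "\<And>C. graph_cycle G C \<Longrightarrow> prod_list (map f C) = 1"
    and edge: "\<And>u v. (u, v) \<in> parcs G \<Longrightarrow> f (u, v) * f (v, u) = 1"
    and walk: "awalk u p u"
  shows "prod_list (map f p) = 1"
  using walk
proof (induction p arbitrary: u rule: length_induct)
  case (1 p)
  show ?case
  proof (cases p)
    case Nil
    then show ?thesis by simp
  next
    case (Cons e p')
    with 1 have e: "e \<in> parcs G" "fst e = u" and p': "awalk (snd e) p' u"
      by (auto simp: awalk_Cons_iff)
    show ?thesis
    proof (cases "distinct (pawalk_verts (snd e) p')")
      case True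
      then have cycle: "cycle p" using "1.prems" Cons e by (auto simp: cycle_def)
      \<comment> \<open>There are no loops, so a cycle has at least two arcs. Length two is not
        covered by \<open>graph_cycle\<close>; there the second arc reverses the first and
        \<open>edge\<close> applies.\<close>
      then have "2 \<le> length p" by (auto simp: cycle_digraph_conv)
      then consider "3 \<le> length p" | "length p = 2" by linarith
      then show ?thesis
      proof cases
        case 1
        then show ?thesis using cycle cyc by (simp add: graph_cycle_def)
      next
        case 2
        then obtain e' where "p = [e, e']" using Cons by (cases p') auto
        moreover from this have "e' = (snd e, fst e)"
          using "1.prems" by (auto simp: awalk_Cons_iff awalk_Nil_iff prod_eq_iff)
        ultimately show ?thesis using edge[of "fst e" "snd e"] e(1) by simp
      qed
    next
      case False
      from awalk_not_distinct_decomp[OF p' False] obtain q r s w where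
        d: "p' = q @ r @ s" "0 < length r" "awalk (snd e) q w" "awalk w r w" "awalk w s u"
        by blast
      have "awalk u (e # q @ s) u" using d e by (auto simp: awalk_Cons_iff)
      \<comment> \<open>\<open>r\<close> is nonempty and omits the leading arc \<open>e\<close>, so
        both closed walks are strictly shorter than \<open>p\<close>.\<close>
      moreover have "length (e # q @ s) < length p" "length r < length p" using d Cons by auto
      ultimately have "prod_list (map f (e # q @ s)) = 1" "prod_list (map f r) = 1"
        using "1.IH" d(4) by blast+
      then show ?thesis using d Cons by (simp add: ac_simps)
    qed
  qed
qed

text \<open>Harary's balance theorem, with potentials built from walks out of a fixed root.\<close>

lemma (in pair_graph) balanced_potential:
  fixes f :: "'a \<times> 'a \<Rightarrow> 'b::comm_semiring_1"
  assumes conn: "connected (with_proj G)"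
    and cyc: "\<And>C. graph_cycle G C \<Longrightarrow> prod_list (map f C) = 1"
    and edge: "\<And>u v. (u, v) \<in> parcs G \<Longrightarrow> f (u, v) * f (v, u) = 1"
  obtains s where "\<And>u v. (u, v) \<in> parcs G \<Longrightarrow> s u * f (u, v) = s v" "\<And>v. s v dvd 1"
proof -
  have reach: "u \<rightarrow>\<^sup>*\<^bsub>with_proj G\<^esub> v" if "u \<in> pverts G" "v \<in> pverts G" for u v
    using symmetric_connected_imp_strongly_connected[OF sym_arcs conn] that
    by (simp add: strongly_connected_def)
  obtain r where r: "r \<in> pverts G"
    using conn by (auto simp: connected_def strongly_connected_def)
  have "\<forall>v. \<exists>p. v \<in> pverts G \<longrightarrow> awalk r p v" using reach[OF r] reachable_awalk by blast
  then obtain P where P: "\<And>v. v \<in> pverts G \<Longrightarrow> awalk r (P v) v" by metis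
  have "\<forall>v. \<exists>p. v \<in> pverts G \<longrightarrow> awalk v p r" using reach[OF _ r] reachable_awalk by blast
  then obtain Q where Q: "\<And>v. v \<in> pverts G \<Longrightarrow> awalk v (Q v) r" by metis
  define w where "w p = prod_list (map f p)" for p
  have w1: "w p = 1" if "awalk u p u" for u p
    using closed_walk_prod[OF cyc edge that] by (simp add: w_def)
  \<comment> \<open>The default 1 off the vertex set makes \<open>s v\<close> a unit for every
    \<open>v\<close> of the type.\<close>
  define s where "s v = (if v \<in> pverts G then w (P v) else 1)" for v
  \<comment> \<open>The walk back to the root supplies an inverse for \<open>w (P v)\<close>; this
    replaces division in the semiring.\<close>
  have PQ: "w (P v) * w (Q v) = 1" if "v \<in> pverts G" for v
    using w1[of r "P v @ Q v"] P[OF that] Q[OF that] by (auto simp: w_def)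
  show thesis
  proof
    fix u v assume uv: "(u, v) \<in> parcs G"
    then have V: "u \<in> pverts G" "v \<in> pverts G" by (auto dest: wellformed')
    have "awalk r (P u @ (u, v) # Q v) r"
      using P[OF V(1)] Q[OF V(2)] uv by (auto simp: awalk_Cons_iff)
    from w1[OF this] have "w (P u) * f (u, v) * w (Q v) = 1"
      by (simp add: w_def ac_simps)
    then have "w (P u) * f (u, v) = w (P v)" using PQ[OF V(2)]
      by (metis mult.assoc mult.commute mult_1)
    then show "s u * f (u, v) = s v" using V by (simp add: s_def)
  next
    fix v show "s v dvd 1" using PQ[of v] by (auto simp: s_def intro: dvdI[OF sym])
  qed
qed

lemma (in pair_graph) constant_on_connected:
  assumes "connected (with_proj G)" "\<And>u v. (u, v) \<in> parcs G \<Longrightarrow> h u = h v"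
    and "u \<in> pverts G" "v \<in> pverts G"
  shows "h u = h v"
proof -
  have "u \<rightarrow>\<^sup>*\<^bsub>with_proj G\<^esub> v"
    using symmetric_connected_imp_strongly_connected[OF sym_arcs assms(1)] assms(3,4)
    by (simp add: strongly_connected_def)
  then obtain p where "awalk u p v" using reachable_awalk by blast
  then show ?thesis
    by (induction p arbitrary: u) (auto simp: awalk_Nil_iff awalk_Cons_iff dest: assms(2))
qed

text \<open>Indexing by lists turns concatenation of vertex lists into block decomposition.\<close>

definition entry_mat :: "('a \<Rightarrow> 'a \<Rightarrow> 'b) \<Rightarrow> 'a list \<Rightarrow> 'a list \<Rightarrow> 'b mat" where
  "entry_mat e xs ys = mat (length xs) (length ys) (\<lambda>(i, j). e (xs ! i) (ys ! j))"

lemma entry_mat_carrier [simp]: "entry_mat e xs ys \<in> carrier_mat (length xs) (length ys)"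
  and entry_mat_dim [simp]:
    "dim_row (entry_mat e xs ys) = length xs" "dim_col (entry_mat e xs ys) = length ys"
  and entry_mat_index [simp]:
    "i < length xs \<Longrightarrow> j < length ys \<Longrightarrow> entry_mat e xs ys $$ (i, j) = e (xs ! i) (ys ! j)"
  by (simp_all add: entry_mat_def)

lemma entry_mat_append:
  "entry_mat e (xs @ xs') (ys @ ys') =
    four_block_mat (entry_mat e xs ys) (entry_mat e xs ys')
      (entry_mat e xs' ys) (entry_mat e xs' ys')"
  by (rule eq_matI) (auto simp: nth_append)

lemma elements_entry_mat:
  assumes "\<And>x y. e x y \<in> S"
  shows "elements_mat (entry_mat e xs ys) \<subseteq> S"
  using assms by (auto dest!: elements_matD)

lemma adj_mat_eq_entry_mat:
  "adj_mat (G, \<sigma>) vs =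
    entry_mat (\<lambda>u v. if (u, v) \<in> parcs G then \<sigma> {u, v} else 0) vs vs"
  by (simp add: entry_mat_def)

text \<open>Reduces form b to sign rules for single entries under \<phi>. The rule \<open>U\<close>
  ranges over both halves so that it also applies to the pair \<open>u\<close>,
  \<open>\<phi> v\<close>; with \<open>invol\<close> and symmetry this yields the block
  \<open>- Y\<close> and the skewness of \<open>Y\<close>.\<close>

lemma has_block_form_bI:
  fixes G :: "'a pair_pre_digraph"
  defines "e \<equiv> \<lambda>\<sigma> u v. if (u, v) \<in> parcs G then \<sigma> {u, v} else (0::int)"
  assumes G: "signed_graph (G, \<sigma>)"
    and fixed: "\<And>w. w \<in> W1 \<union> W2 \<Longrightarrow> \<phi> w = w"
    and invol: "\<And>u. \<phi> (\<phi> u) = u"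
    and W: "bipartition (with_proj G \<restriction> (W1 \<union> W2)) W1 W2"
    and W1: "\<And>w u. w \<in> W1 \<Longrightarrow> u \<in> U \<Longrightarrow> e \<sigma> w (\<phi> u) = - e \<sigma> w u"
    and W2: "\<And>w u. w \<in> W2 \<Longrightarrow> u \<in> U \<Longrightarrow> e \<sigma> w (\<phi> u) = e \<sigma> w u"
    and U: "\<And>u v. u \<in> U \<union> \<phi> ` U \<Longrightarrow> v \<in> U \<union> \<phi> ` U \<Longrightarrow> e \<sigma> (\<phi> u) (\<phi> v) = - e \<sigma> u v"
  shows "has_block_form block_mat_b \<phi> W1 W2 U (G, \<sigma>)"
  unfolding has_block_form_def
proof (intro allI impI, elim conjE)
  fix ws1 ws2 us assume sets: "set ws1 = W1" "set ws2 = W2" "set us = U"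
  interpret pair_graph G using G by simp
  let ?e = "e \<sigma>" and ?us' = "map \<phi> us"
  have sym: "?e u v = ?e v u" for u v
    using sym_arcs by (auto simp: e_def insert_commute dest: arcs_symmetric)
  have val: "?e u v \<in> {0, 1, -1}" for u v
    using G by (auto simp: e_def)
  have loop: "?e u u = 0" for u using no_loops' by (auto simp: e_def)
  have ent: "ws1 ! i \<in> W1" if "i < length ws1" for i using that sets by auto
  have ent2: "ws2 ! i \<in> W2" if "i < length ws2" for i using that sets by auto
  have entU: "us ! i \<in> U" if "i < length us" for i using that sets by auto
  have zero: "?e u v = 0" if "u \<in> W1 \<and> v \<in> W1 \<or> u \<in> W2 \<and> v \<in> W2" for u v
    using W that by (force simp: e_def bipartition_def)
  define M where "M = entry_mat ?e"
  have UU: "?e (\<phi> u) (\<phi> v) = - ?e u v" "?e (\<phi> u) v = - ?e u (\<phi> v)" if "u \<in> U" "v \<in> U" for u v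
    using U[of u v] U[of u "\<phi> v"] that invol by auto
  \<comment> \<open>This grouping of the lists matches the nesting of \<open>four_block_mat\<close>
    in \<open>block_mat_b\<close>.\<close>
  have "adj_mat (G, \<sigma>) (ws1 @ ws2 @ us @ ?us') = M ((ws1 @ ws2) @ us @ ?us') ((ws1 @ ws2) @ us @ ?us')"
    by (simp only: adj_mat_eq_entry_mat M_def e_def append_assoc)
  also have "\<dots> = four_block_mat
      (four_block_mat (M ws1 ws1) (M ws1 ws2) (M ws2 ws1) (M ws2 ws2))
      (four_block_mat (M ws1 us) (M ws1 ?us') (M ws2 us) (M ws2 ?us'))
      (four_block_mat (M us ws1) (M us ws2) (M ?us' ws1) (M ?us' ws2))
      (four_block_mat (M us us) (M us ?us') (M ?us' us) (M ?us' ?us'))"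
    unfolding M_def by (simp only: entry_mat_append)
  also have "\<dots> = block_mat_b (M ws1 ws2) (M us us) (M us ?us') (M ws1 us) (M ws2 us)"
  proof -
    have tr: "M xs ys = transpose_mat (M ys xs)" for xs ys
      by (rule eq_matI) (auto simp: M_def sym)
    have "M ws1 ws1 = 0\<^sub>m (length ws1) (length ws1)" "M ws2 ws2 = 0\<^sub>m (length ws2) (length ws2)"
      by (rule eq_matI; auto simp: M_def zero ent ent2)+
    moreover have neg: "M ws1 ?us' = - M ws1 us" "M ws2 ?us' = M ws2 us"
      "M ?us' us = - M us ?us'" "M ?us' ?us' = - M us us"
      by (rule eq_matI; auto simp: M_def W1 W2 UU ent ent2 entU)+
    moreover have "M ?us' ws1 = - transpose_mat (M ws1 us)"
      unfolding tr[of ?us' ws1] neg(1) by (rule eq_matI) (auto simp: M_def)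
    moreover have "M ?us' ws2 = transpose_mat (M ws2 us)"
      unfolding tr[of ?us' ws2] neg(2) ..
    ultimately show ?thesis
      unfolding block_mat_b_def tr[of us ws1] tr[of us ws2] tr[of ws2 ws1] by (simp add: M_def)
  qed
  finally have form: "adj_mat (G, \<sigma>) (ws1 @ ws2 @ us @ ?us') =
    block_mat_b (M ws1 ws2) (M us us) (M us ?us') (M ws1 us) (M ws2 us)" .
  have B: "transpose_mat (M us us) = M us us"
    by (rule eq_matI) (auto simp: M_def sym)
  have Y: "transpose_mat (M us ?us') = - M us ?us'"
  proof (rule eq_matI)
    have flip: "?e v (\<phi> u) = - ?e u (\<phi> v)" if "u \<in> U" "v \<in> U" for u v
      using UU(2)[OF that] sym[of v "\<phi> u"] by simp
    show "transpose_mat (M us ?us') $$ (i, j) = (- M us ?us') $$ (i, j)"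
      if "i < dim_row (- M us ?us')" "j < dim_col (- M us ?us')" for i j
      using that flip[of "us ! i" "us ! j"] by (simp add: M_def entU)
  qed (simp_all add: M_def)
  have elem: "elements_mat (M xs ys) \<subseteq> {0, 1, -1}" for xs ys
    unfolding M_def by (rule elements_entry_mat) (fact val)
  have carrier: "M xs ys \<in> carrier_mat (length xs) (length ys)" for xs ys
    by (simp add: M_def)
  have diag: "\<forall>i<length us. M us us $$ (i, i) = 0" by (simp add: M_def loop)
  have "admissible_blocks (length ws1) (length ws2) (length us)
      (M ws1 ws2) (M us us) (M us ?us') (M ws1 us) (M ws2 us)"
    unfolding admissible_blocks_def
    using B Y diag carrier[of us ?us'] by (auto intro!: carrier dest: subsetD[OF elem])
  with form show "\<exists>A B Y D1 D2.
      admissible_blocks (length ws1) (length ws2) (length us) A B Y D1 D2 \<and>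
      adj_mat (G, \<sigma>) (ws1 @ ws2 @ us @ ?us') = block_mat_b A B Y D1 D2"
    by blast
qed

theorem theorem4p4:
  fixes G :: "'a pair_pre_digraph" and \<sigma> :: "'a set \<Rightarrow> int"
    and \<phi> :: "'a \<Rightarrow> 'a" and F U1 U2 :: "'a set"
  assumes "pair_graph G"
    and "connected (with_proj G)"
    and "\<not> bipartite (with_proj G)"
    and "(G, \<sigma>) \<in> FS1 G"
    and "principal_weak_aut (G, \<sigma>) \<phi>"
    and "aut_order \<phi> = 2"
    and "F = fixed_verts G \<phi>"
    and "F \<noteq> {}"
    and "phi_factors G \<phi> = {U1 \<union> U2}"
    and "U1 \<inter> U2 = {}"
    and "\<phi> ` U1 = U2"
    and "connected (with_proj G \<restriction> U1)"
    and "connected (with_proj G \<restriction> U2)"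
  shows "\<exists>\<Omega>1 \<Omega>2 \<sigma>'.
    bipartition (with_proj G \<restriction> F) \<Omega>1 \<Omega>2 \<and>
    signed_graph (G, \<sigma>') \<and>
    switching_isomorphic (G, \<sigma>) (G, \<sigma>') \<and>
    (has_block_form block_mat_a \<phi> \<Omega>1 \<Omega>2 U1 (G, \<sigma>') \<or>
     has_block_form block_mat_b \<phi> \<Omega>1 \<Omega>2 U1 (G, \<sigma>'))"
proof -
  interpret pair_graph G by fact
  have sg: "signed_graph (G, \<sigma>)" using assms(4) by (simp add: FS1_def S1_def)
  have sgn: "\<sigma> {u, v} \<in> {1, -1}" if "(u, v) \<in> parcs G" for u v using sg that by auto
  have wa: "weak_aut (G, \<sigma>) \<phi>" using assms(5) by (simp add: principal_weak_aut_def)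
  then have perm: "\<phi> permutes pverts G"
    and arc: "\<And>u v. (u, v) \<in> parcs G \<Longrightarrow> (\<phi> u, \<phi> v) \<in> parcs G"
    by (auto simp: graph_aut_def dest: wellformed')
  have "\<phi> ^^ 2 = id"
  proof -
    \<comment> \<open>A permutation of a finite set has finite order, so the \<open>LEAST\<close> in
      \<open>aut_order\<close> is attained.\<close>
    obtain n where "\<phi> ^^ n = id" "0 < n"
      using permutation_is_nilpotent permutation_permutes perm pair_finite_verts by metis
    then show ?thesis using LeastI[of "\<lambda>n. 0 < n \<and> \<phi> ^^ n = id"] assms(6)
      by (simp add: aut_order_def)
  qed
  then have invol: "\<phi> (\<phi> u) = u" for u by (auto simp: fun_eq_iff numeral_2_eq_2)

  \<comment> \<open>The sign function of the twist by \<phi>\<close>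
  define f where "f = (\<lambda>(u, v). - (\<sigma> {\<phi> u, \<phi> v} * \<sigma> {u, v}))"
  have f_sq: "f (u, v) * f (v, u) = 1" if "(u, v) \<in> parcs G" for u v
    using sgn[OF that] sgn[OF arc[OF that]] by (auto simp: f_def insert_commute)
  \<comment> \<open>The minus sign in \<open>f\<close> contributes -1 per arc, which cancels the
    sign change that a weak automorphism makes on odd cycles.\<close>
  have f_cycle: "prod_list (map f C) = 1" if C: "graph_cycle G C" for C
  proof -
    have "cycle_sign \<sigma> C \<in> {1, -1}" if "set C \<subseteq> parcs G" for C
      using that by (induction C) (use sgn in \<open>fastforce simp: cycle_sign_def\<close>)+
    moreover have "set C \<subseteq> parcs G"
      using C by (auto simp: graph_cycle_def cycle_def)
    ultimately have sq: "cycle_sign \<sigma> C * cycle_sign \<sigma> C = 1" by force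
    have "prod_list (map f C) =
        (- 1) ^ length C * (cycle_sign \<sigma> (map (map_prod \<phi> \<phi>) C) * cycle_sign \<sigma> C)"
      by (induction C) (auto simp: f_def cycle_sign_def)
    also have "\<dots> = 1" using wa C sq by auto
    finally show ?thesis .
  qed
  obtain s where s: "\<And>u v. (u, v) \<in> parcs G \<Longrightarrow> s u * f (u, v) = s v"
    and "\<And>v. s v dvd 1"
    using balanced_potential[OF assms(2) f_cycle f_sq] by blast
  then have s_sgn: "s v \<in> {1, -1}" for v by (metis insert_iff zdvd1_eq abs_1 abs_eq_iff)
  have s_sq: "s v * s v = 1" for v using s_sgn[of v] by auto
  have twist: "\<sigma> {\<phi> u, \<phi> v} = - s u * s v * \<sigma> {u, v}" if "(u, v) \<in> parcs G" for u v
    using s[OF that] sgn[OF that] sgn[OF arc[OF that]] s_sgn[of u] s_sgn[of v]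
    by (auto simp: f_def)
  have s_inv: "s (\<phi> u) = s u" if "u \<in> pverts G" for u
  proof -
    obtain w where w: "w \<in> pverts G" "\<phi> w = w" using assms by (auto simp: fixed_verts_def)
    \<comment> \<open>Twisting the edge twice returns its original sign, so the four values of
      \<open>s\<close> multiply to 1.\<close>
    have "s u * s (\<phi> u) = s v * s (\<phi> v)" if "(u, v) \<in> parcs G" for u v
      using twist[OF that] twist[OF arc[OF that]] sgn[OF that]
        s_sgn[of u] s_sgn[of v] s_sgn[of "\<phi> u"] s_sgn[of "\<phi> v"]
      by (auto simp: invol)
    from constant_on_connected[of "\<lambda>u. s u * s (\<phi> u)", OF assms(2) this \<open>u \<in> pverts G\<close> w(1)]
    have "s u * s (\<phi> u) = 1" using s_sq[of w] w by simp
    then show ?thesis using s_sgn[of u] s_sgn[of "\<phi> u"] by auto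
  qed

  \<comment> \<open>Switching on the moved vertices\<close>
  have notF: "\<phi> u \<noteq> u" if "u \<in> U1 \<union> U2" for u
    using that assms(10,11) invol by (metis Int_iff UnE empty_iff imageE imageI)
  \<comment> \<open>A permutation of the vertex set fixes every point outside it.\<close>
  have U_verts: "u \<in> pverts G" if "u \<in> U1 \<union> U2" for u
    using notF[OF that] perm by (auto simp: permutes_def)
  have U21: "\<phi> u \<in> U1" if "u \<in> U2" for u using that assms(11) invol by auto

  define T where "T = {u \<in> U2. s u = -1}"
  define t :: "'a \<Rightarrow> int" where "t u = (if u \<in> T then -1 else 1)" for u
  define \<sigma>' where "\<sigma>' = snd (switching T (G, \<sigma>))"
  have switch: "switching T (G, \<sigma>) = (G, \<sigma>')" by (simp add: \<sigma>'_def)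
  have \<sigma>': "\<sigma>' {u, v} = t u * t v * \<sigma> {u, v}" if "(u, v) \<in> parcs G" for u v
    using that by (auto simp: \<sigma>'_def t_def dest: wellformed')
  have sg': "signed_graph (G, \<sigma>')"
  proof -
    have "\<sigma>' {u, v} \<in> {1, -1}" if "(u, v) \<in> parcs G" for u v
      using sgn[OF that] \<sigma>'[OF that] by (auto simp: t_def)
    then show ?thesis using pair_graph by auto
  qed
  have iso: "switching_isomorphic (G, \<sigma>) (G, \<sigma>')"
    unfolding switching_isomorphic_def
  proof (intro exI conjI)
    show "T \<subseteq> pverts (fst (G, \<sigma>'))" using U_verts by (auto simp: T_def)
    \<comment> \<open>Switching twice at the same set restores the signature.\<close>
    have "snd (switching T (G, \<sigma>')) {u, v} = \<sigma> {u, v}" if "(u, v) \<in> parcs G" for u v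
      using that \<sigma>'[OF that] by (auto simp: t_def dest: wellformed')
    moreover have "switching T (G, \<sigma>') = (G, snd (switching T (G, \<sigma>')))" by simp
    ultimately show "signed_iso id (G, \<sigma>) (switching T (G, \<sigma>'))"
      by (elim ssubst) (auto simp: bij_betw_def simp del: switching.simps)
  qed

  \<comment> \<open>\<open>r\<close> is the sign function \<open>s\<close> of the switched graph\<close>
  define r where "r u = (if u \<in> U1 \<union> U2 then 1 else s u)" for u
  \<comment> \<open>Switching replaces \<open>s u\<close> by
    \<open>s u * t u * t (\<phi> u)\<close>. By \<open>s_inv\<close>, if \<open>s u = -1\<close> off
    \<open>F\<close> then exactly one of \<open>u\<close>, \<open>\<phi> u\<close> lies in
    \<open>T\<close>, and neither does if \<open>s u = 1\<close>. On \<open>F\<close> both factors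
    \<open>t\<close> are 1.\<close>
  have r: "s u * t u * t (\<phi> u) = r u" if "u \<in> U1 \<union> U2 \<union> F" for u
    using that assms(7,10,11) s_inv[of u] s_sgn[of u] notF[of u] U_verts[of u] U21[of u]
    by (auto simp: r_def t_def T_def fixed_verts_def)
  have twist': "\<sigma>' {\<phi> u, \<phi> v} = - r u * r v * \<sigma>' {u, v}"
    if "(u, v) \<in> parcs G" "u \<in> U1 \<union> U2 \<union> F" "v \<in> U1 \<union> U2 \<union> F" for u v
  proof -
    have tt: "t x * t x = 1" for x by (simp add: t_def)
    have "\<sigma>' {\<phi> u, \<phi> v} = - (t (\<phi> u) * s u) * (t (\<phi> v) * s v) * \<sigma> {u, v}"
      using \<sigma>'[OF arc[OF that(1)]] twist[OF that(1)] by simp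
    also have "\<dots> = - (t (\<phi> u) * s u) * (t (\<phi> v) * s v) * (t u * t u) * (t v * t v) * \<sigma> {u, v}"
      by (simp add: tt)
    also have "\<dots> = - (s u * t u * t (\<phi> u)) * (s v * t v * t (\<phi> v)) * (t u * t v * \<sigma> {u, v})"
      by (simp only: ac_simps mult_minus_left mult_minus_right)
    finally show ?thesis using r that \<sigma>' by simp
  qed

  \<comment> \<open>Bipartition of the fixed vertices and the block form\<close>
  define \<Omega>1 where "\<Omega>1 = {v \<in> F. s v = 1}"
  define \<Omega>2 where "\<Omega>2 = {v \<in> F. s v = -1}"
  have F: "F = \<Omega>1 \<union> \<Omega>2" using s_sgn by (auto simp: \<Omega>1_def \<Omega>2_def)
  \<comment> \<open>\<phi> fixes such an edge, so the twist relation reads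
    \<open>s u * s v = -1\<close>.\<close>
  have "s u \<noteq> s v" if "(u, v) \<in> parcs G" "u \<in> F" "v \<in> F" for u v
    using twist[OF that(1)] that sgn[OF that(1)] s_sq assms(7)
    by (auto simp: fixed_verts_def mult.assoc)
  then have "\<not> (u \<in> \<Omega>1 \<and> v \<in> \<Omega>1) \<and> \<not> (u \<in> \<Omega>2 \<and> v \<in> \<Omega>2)" if "(u, v) \<in> parcs G" for u v
    using that unfolding \<Omega>1_def \<Omega>2_def by fastforce
  then have bip: "bipartition (with_proj G \<restriction> F) \<Omega>1 \<Omega>2"
    unfolding bipartition_def by (auto simp: F) (auto simp: \<Omega>1_def \<Omega>2_def)
  have "has_block_form block_mat_b \<phi> \<Omega>1 \<Omega>2 U1 (G, \<sigma>')"
  proof (rule has_block_form_bI[OF sg'])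
    let ?e = "\<lambda>u v. if (u, v) \<in> parcs G then \<sigma>' {u, v} else 0"
    have e: "?e (\<phi> u) (\<phi> v) = - r u * r v * ?e u v"
      if "u \<in> U1 \<union> U2 \<union> F" "v \<in> U1 \<union> U2 \<union> F" for u v
      \<comment> \<open>Applying \<open>arc\<close> a second time shows that non-edges go to
        non-edges, where both entries are 0.\<close>
      using twist'[OF _ that] arc[of u v] arc[of "\<phi> u" "\<phi> v"] by (auto simp: invol)
    have fixF: "\<phi> w = w" if "w \<in> F" for w using that assms(7) by (simp add: fixed_verts_def)
    then have rF: "r w = s w" if "w \<in> F" for w using that notF by (auto simp: r_def)
    show "\<phi> w = w" if "w \<in> \<Omega>1 \<union> \<Omega>2" for w using that fixF F by simp
    show "\<phi> (\<phi> u) = u" for u by (fact invol)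
    show "bipartition (with_proj G \<restriction> (\<Omega>1 \<union> \<Omega>2)) \<Omega>1 \<Omega>2" using bip F by simp
    \<comment> \<open>The factor \<open>- r w * r u\<close> is -1 for \<open>w\<close> in
      \<open>\<Omega>1\<close> and 1 for \<open>w\<close> in \<open>\<Omega>2\<close>, since
      \<open>r u = 1\<close>; between moved vertices it is -1.\<close>
    show "?e w (\<phi> u) = - ?e w u" if "w \<in> \<Omega>1" "u \<in> U1" for w u
      using e[of w u] fixF[of w] rF[of w] that by (auto simp: \<Omega>1_def r_def)
    show "?e w (\<phi> u) = ?e w u" if "w \<in> \<Omega>2" "u \<in> U1" for w u
      using e[of w u] fixF[of w] rF[of w] that by (auto simp: \<Omega>2_def r_def)
    show "?e (\<phi> u) (\<phi> v) = - ?e u v" if "u \<in> U1 \<union> \<phi> ` U1" "v \<in> U1 \<union> \<phi> ` U1" for u v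
      using e[of u v] that assms(11) by (auto simp: r_def)
  qed
  with bip sg' iso show ?thesis by blast
qed

end
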